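(* If $\models_{\mathbf{A}} S$ for a sequent $S$, then $S$ is derivable in $\mathbf{GA_s}$.
   Context: Formulas are built from propositional variables and $t$ using $+,\to,\Rightarrow$ (binary) and $\lnot$; a valuation $v$ into $\mathbb{Q}$ satisfies $v(t)=0$, $v(A+B)=v(A)+v(B)$, $v(\lnot A)=-v(A)$, $v(A\to B)=v(B)-v(A)$, $v(A\Rightarrow B)=\min(0,v(B)-v(A))$ (i.e. $A\Rightarrow B=(A\to B)\land t$). A sequent $\Gamma\vdash\Delta$ is a pair of finite multisets of formulas; $\models_{\mathbf{A}}\Gamma\vdash\Delta$ means $\sum_{A\in\Gamma}v(A)\le\sum_{B\in\Delta}v(B)$ for every valuation $v$ (empty sum $0$). Calculus $\mathbf{GA_s}$ (premise(s) / conclusion; commas are multiset union): axioms $A\vdash A$ and $\vdash$; (W) $\Gamma\vdash\Delta/\Gamma,A\Rightarrow B\vdash\Delta$; (M) premises $\Gamma_1\vdash\Delta_1$ and $\Gamma_2\vdash\Delta_2$, conclusion $\Gamma_1,\Gamma_2\vdash\Delta_1,\Delta_2$; (C) from $\Gamma,\ldots,\Gamma\vdash\Delta,\ldots,\Delta$ ($n$ copies of each, $n>0$) infer $\Gamma\vdash\Delta$; $(t,l)$ $\Gamma\vdash\Delta/\Gamma,t\vdash\Delta$; $(t,r)$ $\Gamma\vdash\Delta/\Gamma\vdash t,\Delta$; $(\lnot,l)$ $\Gamma\vdash A,\Delta/\Gamma,\lnot A\vdash\Delta$; $(\lnot,r)$ $\Gamma,A\vdash\Delta/\Gamma\vdash\lnot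 A,\Delta$; $(\to,l)$ $\Gamma,B\vdash A,\Delta/\Gamma,A\to B\vdash\Delta$; $(\to,r)$ $\Gamma,A\vdash B,\Delta/\Gamma\vdash A\to B,\Delta$; $(+,l)$ $\Gamma,A,B\vdash\Delta/\Gamma,A+B\vdash\Delta$; $(+,r)$ $\Gamma\vdash A,B,\Delta/\Gamma\vdash A+B,\Delta$; $(\Rightarrow,l)$ $\Gamma,B,B\Rightarrow A\vdash\Delta,A/\Gamma,A\Rightarrow B\vdash\Delta$; $(\Rightarrow,r)$ premises $\Gamma\vdash\Delta$ and $\Gamma,A\vdash\Delta,B$, conclusion $\Gamma\vdash\Delta,A\Rightarrow B$. *)

theory Defs
  imports Complex_Main "HOL-Library.Multiset"
begin

datatype 'p form =
    Var 'p
  | Truth  ("\<^bold>t")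
  | Neg "'p form"  ("\<^bold>\<not> _" [80] 80)
  | Plus "'p form" "'p form"  (infixl "\<^bold>+" 75)
  | Imp "'p form" "'p form"  (infixr "\<^bold>\<rightarrow>" 70)
  | BImp "'p form" "'p form"  (infixr "\<^bold>\<Rightarrow>" 70)

definition valuation :: "('p form \<Rightarrow> rat) \<Rightarrow> bool" where
  "valuation v \<longleftrightarrow>
     v \<^bold>t = 0 \<and>
     (\<forall>A B. v (A \<^bold>+ B) = v A + v B) \<and>
     (\<forall>A. v (\<^bold>\<not> A) = - v A) \<and>
     (\<forall>A B. v (A \<^bold>\<rightarrow> B) = v B - v A) \<and>
     (\<forall>A B. v (A \<^bold>\<Rightarrow> B) = min 0 (v B - v A))"

datatype 'p sequent = Sequent "'p form multiset" "'p form multiset"  (infix "\<turnstile>" 55)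

fun valid_A :: "'p sequent \<Rightarrow> bool"  ("\<Turnstile>\<^sub>A _" [50] 50) where
  "(\<Turnstile>\<^sub>A \<Gamma> \<turnstile> \<Delta>) \<longleftrightarrow>
     (\<forall>v. valuation v \<longrightarrow> (\<Sum>A\<in>#\<Gamma>. v A) \<le> (\<Sum>B\<in>#\<Delta>. v B))"

inductive GAs :: "'p sequent \<Rightarrow> bool" where
  ID: "GAs ({#A#} \<turnstile> {#A#})"
| EMP: "GAs ({#} \<turnstile> {#})"
| W: "GAs (\<Gamma> \<turnstile> \<Delta>) \<Longrightarrow> GAs (\<Gamma> + {#A \<^bold>\<Rightarrow> B#} \<turnstile> \<Delta>)"
| M: "GAs (\<Gamma>1 \<turnstile> \<Delta>1) \<Longrightarrow> GAs (\<Gamma>2 \<turnstile> \<Delta>2) \<Longrightarrow> GAs (\<Gamma>1 + \<Gamma>2 \<turnstile> \<Delta>1 + \<Delta>2)"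
| C: "n > 0 \<Longrightarrow> GAs (repeat_mset n \<Gamma> \<turnstile> repeat_mset n \<Delta>) \<Longrightarrow> GAs (\<Gamma> \<turnstile> \<Delta>)"
| tL: "GAs (\<Gamma> \<turnstile> \<Delta>) \<Longrightarrow> GAs (\<Gamma> + {#\<^bold>t#} \<turnstile> \<Delta>)"
| tR: "GAs (\<Gamma> \<turnstile> \<Delta>) \<Longrightarrow> GAs (\<Gamma> \<turnstile> {#\<^bold>t#} + \<Delta>)"
| NegL: "GAs (\<Gamma> \<turnstile> {#A#} + \<Delta>) \<Longrightarrow> GAs (\<Gamma> + {#\<^bold>\<not> A#} \<turnstile> \<Delta>)"
| NegR: "GAs (\<Gamma> + {#A#} \<turnstile> \<Delta>) \<Longrightarrow> GAs (\<Gamma> \<turnstile> {#\<^bold>\<not> A#} + \<Delta>)"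
| ImpL: "GAs (\<Gamma> + {#B#} \<turnstile> {#A#} + \<Delta>) \<Longrightarrow> GAs (\<Gamma> + {#A \<^bold>\<rightarrow> B#} \<turnstile> \<Delta>)"
| ImpR: "GAs (\<Gamma> + {#A#} \<turnstile> {#B#} + \<Delta>) \<Longrightarrow> GAs (\<Gamma> \<turnstile> {#A \<^bold>\<rightarrow> B#} + \<Delta>)"
| PlusL: "GAs (\<Gamma> + {#A, B#} \<turnstile> \<Delta>) \<Longrightarrow> GAs (\<Gamma> + {#A \<^bold>+ B#} \<turnstile> \<Delta>)"
| PlusR: "GAs (\<Gamma> \<turnstile> {#A, B#} + \<Delta>) \<Longrightarrow> GAs (\<Gamma> \<turnstile> {#A \<^bold>+ B#} + \<Delta>)"
| BImpL: "GAs (\<Gamma> + {#B, B \<^bold>\<Rightarrow> A#} \<turnstile> \<Delta> + {#A#}) \<Longrightarrow> GAs (\<Gamma> + {#A \<^bold>\<Rightarrow> B#} \<turnstile> \<Delta>)"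
| BImpR: "GAs (\<Gamma> \<turnstile> \<Delta>) \<Longrightarrow> GAs (\<Gamma> + {#A#} \<turnstile> \<Delta> + {#B#}) \<Longrightarrow> GAs (\<Gamma> \<turnstile> \<Delta> + {#A \<^bold>\<Rightarrow> B#})"

end

theory Submission
  imports Defs
begin

text \<open>Let \<open>C \<^bold>\<Rightarrow> D\<close> be a proper subformula of an implication \<open>A \<^bold>\<Rightarrow> B\<close> on the left. Since the left
  rule for \<open>\<^bold>\<Rightarrow>\<close> can be iterated, \<open>C \<^bold>\<Rightarrow> D\<close> may be introduced on both sides at once. Splitting
  its right occurrence gives a case distinction: it suffices to prove the sequent with many extra
  copies of \<open>C \<^bold>\<Rightarrow> D\<close> on the left, and with many extra copies of \<open>D \<^bold>\<Rightarrow> C\<close>. These copies are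
  penalties (in the sense of Lagrange multipliers) for the constraints that \<open>C\<close> is at most \<open>D\<close>,
  or conversely. Once the order of all such pairs is fixed, the arguments of the outermost
  implications are linear, and Farkas' lemma over \<open>\<rat>\<close> yields a combination, with natural
  coefficients, that is derivable by purely linear reasoning; rule (C) divides by the coefficient
  of the sequent.\<close>

section \<open>Linear functionals over the rationals\<close>

text \<open>Additivity and homogeneity in one equation. Functions on an arbitrary index type serve
  as vectors, so assignments to the variables are vectors directly.\<close>

definition linear_functional :: "(('x \<Rightarrow> rat) \<Rightarrow> rat) \<Rightarrow> bool" where
  "linear_functional f \<longleftrightarrow> (\<forall>v a w. f (\<lambda>x. v x + a * w x) = f v + a * f w)"

lemma linear_functional_add_scaled:
  "linear_functional f \<Longrightarrow> f (\<lambda>x. v x + a * w x) = f v + a * f w"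
  by (simp add: linear_functional_def)

lemma linear_functional_zero: "linear_functional f \<Longrightarrow> f (\<lambda>x. 0) = 0"
  \<comment> \<open>For \<open>v = w = 0\<close> and \<open>a = -1\<close> linearity reads
    \<open>f 0 = f 0 - f 0\<close>.\<close>
  using linear_functional_add_scaled[of f "\<lambda>x. 0" "-1" "\<lambda>x. 0"] by simp

lemma linear_functional_scale: "linear_functional f \<Longrightarrow> f (\<lambda>x. a * w x) = a * f w"
  using linear_functional_add_scaled[of f "\<lambda>x. 0" a w] by (simp add: linear_functional_zero)

lemma linear_functional_diff:
  "linear_functional f \<Longrightarrow> linear_functional g \<Longrightarrow> linear_functional (\<lambda>v. f v - g v)"
  by (simp add: linear_functional_def algebra_simps)

lemma linear_functional_uminus: "linear_functional f \<Longrightarrow> linear_functional (\<lambda>v. - f v)"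
  by (simp add: linear_functional_def algebra_simps)

lemma linear_functional_add:
  "linear_functional f \<Longrightarrow> linear_functional g \<Longrightarrow> linear_functional (\<lambda>v. f v + g v)"
  by (simp add: linear_functional_def algebra_simps)

lemma linear_functional_reindex:
  "linear_functional f \<Longrightarrow> linear_functional (\<lambda>u. f (\<lambda>x. u (h x)))"
  by (simp add: linear_functional_def)

lemma linear_functional_eval: "linear_functional (\<lambda>u. u x)"
  by (simp add: linear_functional_def)

lemma linear_functional_sum_mset:
  "(\<And>i. i \<in># M \<Longrightarrow> linear_functional (f i)) \<Longrightarrow> linear_functional (\<lambda>v. \<Sum>i\<in>#M. f i v)"
proof (induction M)
  case empty
  show ?case by (simp add: linear_functional_def)
next
  case (add i M)
  then show ?case by (auto intro!: linear_functional_add)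
qed

section \<open>Multiset sums and Farkas' lemma\<close>

lemma sum_mset_add_scaled:
  fixes f g :: "'i \<Rightarrow> rat"
  shows "(\<Sum>i\<in>#M. f i + a * g i) = (\<Sum>i\<in>#M. f i) + a * (\<Sum>i\<in>#M. g i)"
  by (induction M) (simp_all add: algebra_simps)

lemma sum_mset_repeat_mset:
  fixes f :: "'i \<Rightarrow> rat"
  shows "(\<Sum>i\<in>#repeat_mset n M. f i) = of_nat n * (\<Sum>i\<in>#M. f i)"
  by (induction n) (simp_all add: algebra_simps)

lemma in_repeat_mset_iff: "x \<in># repeat_mset n M \<longleftrightarrow> n > 0 \<and> x \<in># M"
  by (simp flip: count_greater_zero_iff)

lemma sum_mset_rat_nonneg:
  fixes f :: "'i \<Rightarrow> rat"
  shows "(\<And>i. i \<in># M \<Longrightarrow> 0 \<le> f i) \<Longrightarrow> 0 \<le> (\<Sum>i\<in>#M. f i)"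
  by (induction M) simp_all

text \<open>Bartl's induction on the number of constraints: if the new constraint \<open>f j\<close> is needed,
  there is \<open>w\<close> with \<open>f j w = -1\<close> that satisfies the others but violates the conclusion, and
  the induction hypothesis is applied after projecting onto the kernel of \<open>f j\<close> along \<open>w\<close>.\<close>

lemma farkas:
  fixes f :: "'i \<Rightarrow> ('x \<Rightarrow> rat) \<Rightarrow> rat"
  assumes "finite J" "\<And>j. j \<in> J \<Longrightarrow> linear_functional (f j)" "linear_functional g"
    and "\<And>v. (\<forall>j\<in>J. 0 \<le> f j v) \<Longrightarrow> 0 \<le> g v"
  shows "\<exists>n K. n > 0 \<and> set_mset K \<subseteq> J \<and> (\<forall>v. of_nat n * g v = (\<Sum>j\<in>#K. f j v))"
  using assms
proof (induction J arbitrary: f g rule: finite_induct)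
  case empty
  have "g v = 0" for v
  proof -
    have "g (\<lambda>x. -1 * v x) = - g v"
      using linear_functional_scale[OF empty.prems(2), of "-1" v] by simp
    moreover have "0 \<le> g v" "0 \<le> g (\<lambda>x. -1 * v x)"
      using empty.prems(3) by blast+
    ultimately show ?thesis by simp
  qed
  then show ?case by (intro exI[of _ 1] exI[of _ "{#}"]) simp
next
  case (insert j J)
  have lin: "linear_functional (f i)" if "i \<in> insert j J" for i
    using insert.prems(1) that by blast
  show ?case
  proof (cases "\<forall>v. (\<forall>i\<in>J. 0 \<le> f i v) \<longrightarrow> 0 \<le> g v")
    case True
    then obtain n K where "n > 0" "set_mset K \<subseteq> J" "\<forall>v. of_nat n * g v = (\<Sum>i\<in>#K. f i v)"
      using insert.IH[of f g] lin insert.prems(2) by blast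
    then show ?thesis by blast
  next
    case False
    then obtain u where u: "\<forall>i\<in>J. 0 \<le> f i u" "g u < 0" by force
    \<comment> \<open>Otherwise \<open>u\<close> would satisfy all constraints, \<open>j\<close>
      included, contradicting \<open>g u < 0\<close>.\<close>
    have fju: "f j u < 0"
      using insert.prems(3)[of u] u by force
    define w where "w = (\<lambda>x. (- 1 / f j u) * u x)"
    have w: "f j w = -1" "\<forall>i\<in>J. 0 \<le> f i w" "g w < 0"
      using u fju lin insert.prems(2)
      by (auto simp only: w_def linear_functional_scale insertI1 insertI2)
         (auto simp: field_simps mult_le_0_iff)
    define pr where "pr v = (\<lambda>x. v x + f j v * w x)" for v
    have pr_f: "f i (pr v) = f i v + f j v * f i w" if "i \<in> insert j J" for i v
      using lin[OF that] by (simp add: pr_def linear_functional_add_scaled)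
    have pr_g: "g (pr v) = g v + f j v * g w" for v
      using insert.prems(2) by (simp add: pr_def linear_functional_add_scaled)
    have pr_lin: "linear_functional (\<lambda>v. h v + f j v * h w)" if "linear_functional h" for h
      using that lin[of j] by (simp add: linear_functional_def algebra_simps)
    have "\<exists>n K. n > 0 \<and> set_mset K \<subseteq> J \<and>
        (\<forall>v. of_nat n * (g v + f j v * g w) = (\<Sum>i\<in>#K. f i v + f j v * f i w))"
    proof (rule insert.IH[of "\<lambda>i v. f i v + f j v * f i w" "\<lambda>v. g v + f j v * g w"])
      show "linear_functional (\<lambda>v. f i v + f j v * f i w)" if "i \<in> J" for i
        using pr_lin lin that by blast
      show "linear_functional (\<lambda>v. g v + f j v * g w)"
        using pr_lin insert.prems(2) by blast
      show "0 \<le> g v + f j v * g w" if "\<forall>i\<in>J. 0 \<le> f i v + f j v * f i w" for v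
      proof -
        \<comment> \<open>\<open>f j\<close> vanishes at \<open>pr v\<close>; the other constraints
          there are the ones assumed of \<open>v\<close>.\<close>
        have "\<forall>i\<in>insert j J. 0 \<le> f i (pr v)"
          using that w(1) pr_f by simp
        then show ?thesis using insert.prems(3)[of "pr v"] pr_g by simp
      qed
    qed
    then obtain n K where nK: "n > 0" "set_mset K \<subseteq> J"
      "\<And>v. of_nat n * (g v + f j v * g w) = (\<Sum>i\<in>#K. f i v) + f j v * (\<Sum>i\<in>#K. f i w)"
      by (auto simp: sum_mset_add_scaled)
    \<comment> \<open>\<open>r\<close> is the multiplier of \<open>f j\<close> when the identity is
      solved for \<open>of_nat n * g v\<close>. It is nonnegative since \<open>f i w \<ge> 0\<close>
      on \<open>K\<close> and \<open>g w < 0\<close>.\<close>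
    define r where "r = (\<Sum>i\<in>#K. f i w) - of_nat n * g w"
    have "0 \<le> (\<Sum>i\<in>#K. f i w)"
      using w(2) nK(2) by (intro sum_mset_rat_nonneg) blast
    moreover have "of_nat n * g w \<le> 0"
      using w(3) by (simp add: mult_nonneg_nonpos)
    ultimately have "0 \<le> r" by (simp add: r_def)
    \<comment> \<open>The denominator \<open>q\<close> of \<open>r\<close> is multiplied into the
      identity so that all multipliers become natural numbers.\<close>
    obtain a b where ab: "r = Fract a b" "b > 0"
      by (cases r) auto
    define p q where "p = nat a" and "q = nat b"
    have q: "q > 0" and r_eq: "of_nat q * r = of_nat p"
      using ab \<open>0 \<le> r\<close> by (auto simp: p_def q_def zero_le_Fract_iff) (simp add: Fract_of_int_quotient)
    have "of_nat (n * q) * g v = (\<Sum>i\<in>#repeat_mset q K + replicate_mset p j. f i v)" for v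
    proof -
      have "of_nat (n * q) * g v
          = of_nat q * (of_nat n * (g v + f j v * g w) - of_nat n * (f j v * g w))"
        by (simp add: algebra_simps)
      also have "\<dots> = of_nat q * (\<Sum>i\<in>#K. f i v) + (of_nat q * r) * f j v"
        unfolding nK(3) by (simp add: r_def algebra_simps)
      finally show ?thesis
        by (simp add: r_eq sum_mset_repeat_mset)
    qed
    moreover have "set_mset (repeat_mset q K + replicate_mset p j) \<subseteq> insert j J"
      using nK(2) by (auto simp: in_repeat_mset_iff split: if_splits)
    ultimately show ?thesis
      using nK(1) q by (intro exI[of _ "n * q"] exI[of _ "repeat_mset q K + replicate_mset p j"]) auto
  qed
qed

section \<open>A theorem of alternatives\<close>

lemma mset_sum_type_split:
  "set_mset K \<subseteq> Inl ` A \<union> Inr ` B \<Longrightarrow>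
    \<exists>K1 K2. K = image_mset Inl K1 + image_mset Inr K2 \<and> set_mset K1 \<subseteq> A \<and> set_mset K2 \<subseteq> B"
proof (induction K)
  case empty
  show ?case by (intro exI[of _ "{#}"]) simp
next
  case (add x K)
  then obtain K1 K2 where K: "K = image_mset Inl K1 + image_mset Inr K2"
    "set_mset K1 \<subseteq> A" "set_mset K2 \<subseteq> B" by auto
  consider a where "x = Inl a" "a \<in> A" | b where "x = Inr b" "b \<in> B"
    using add.prems by auto
  then show ?case
  proof cases
    case 1
    then show ?thesis using K by (intro exI[of _ "add_mset a K1"] exI[of _ K2]) simp
  next
    case 2
    then show ?thesis using K by (intro exI[of _ K1] exI[of _ "add_mset b K2"]) simp
  qed
qed

text \<open>The extra coordinate \<open>None\<close> bounds all \<open>g c\<close> from above by its negative; the hypothesis says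
  that it cannot be positive.\<close>

lemma farkas_alternative:
  fixes f :: "'i \<Rightarrow> ('x \<Rightarrow> rat) \<Rightarrow> rat" and g :: "'c \<Rightarrow> ('x \<Rightarrow> rat) \<Rightarrow> rat"
  assumes "finite J" "\<And>j. j \<in> J \<Longrightarrow> linear_functional (f j)"
    and "finite I" "\<And>c. c \<in> I \<Longrightarrow> linear_functional (g c)"
    and alt: "\<And>v. (\<forall>j\<in>J. 0 \<le> f j v) \<Longrightarrow> \<exists>c\<in>I. 0 \<le> g c v"
  shows "\<exists>M K. M \<noteq> {#} \<and> set_mset M \<subseteq> I \<and> set_mset K \<subseteq> J \<and>
    (\<forall>v. (\<Sum>c\<in>#M. g c v) = (\<Sum>j\<in>#K. f j v))"
proof -
  define F :: "'i + 'c \<Rightarrow> ('x option \<Rightarrow> rat) \<Rightarrow> rat" where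
    "F = case_sum (\<lambda>j u. f j (\<lambda>x. u (Some x))) (\<lambda>c u. - g c (\<lambda>x. u (Some x)) - u None)"
  have "\<exists>n K. n > 0 \<and> set_mset K \<subseteq> Inl ` J \<union> Inr ` I \<and>
      (\<forall>u. of_nat n * (- u None) = (\<Sum>j\<in>#K. F j u))"
  proof (rule farkas)
    show "finite (Inl ` J \<union> Inr ` I)" using assms(1,3) by simp
    show "linear_functional (F k)" if "k \<in> Inl ` J \<union> Inr ` I" for k
      using that
    proof
      assume "k \<in> Inl ` J"
      then show ?thesis
        using linear_functional_reindex[OF assms(2), of _ Some] by (auto simp: F_def)
    next
      assume "k \<in> Inr ` I"
      then obtain c where "k = Inr c" "linear_functional (g c)" using assms(4) by blast
      then show ?thesis
        using linear_functional_diff[OF linear_functional_uminus[OF linear_functional_reindex]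
            linear_functional_eval, of "g c" Some None]
        by (simp add: F_def)
    qed
    show "linear_functional (\<lambda>u. - u None :: rat)"
      by (intro linear_functional_uminus linear_functional_eval)
    show "0 \<le> - u None" if "\<forall>k\<in>Inl ` J \<union> Inr ` I. 0 \<le> F k u" for u
    proof -
      have "0 \<le> F (Inl j) u" if "j \<in> J" for j
        using that \<open>\<forall>k\<in>Inl ` J \<union> Inr ` I. 0 \<le> F k u\<close> by blast
      then have "\<forall>j\<in>J. 0 \<le> f j (\<lambda>x. u (Some x))" by (simp add: F_def)
      from alt[OF this] obtain c where "c \<in> I" "0 \<le> g c (\<lambda>x. u (Some x))" ..
      moreover have "0 \<le> F (Inr c) u" using that \<open>c \<in> I\<close> by blast
      ultimately show ?thesis by (simp add: F_def)
    qed
  qed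
  then obtain n N where N: "n > 0" "set_mset N \<subseteq> Inl ` J \<union> Inr ` I"
    "\<And>u. of_nat n * (- u None) = (\<Sum>j\<in>#N. F j u)" by blast
  obtain K M where KM: "N = image_mset Inl K + image_mset Inr M" "set_mset K \<subseteq> J" "set_mset M \<subseteq> I"
    using mset_sum_type_split[OF N(2)] by blast
  have eq: "of_nat n * (- z) = (\<Sum>j\<in>#K. f j v) + (\<Sum>c\<in>#M. - g c v - z)" for v z
    using N(3)[of "\<lambda>k. case k of None \<Rightarrow> z | Some x \<Rightarrow> v x"]
    by (simp add: KM(1) F_def multiset.map_comp comp_def)
  \<comment> \<open>At \<open>v = 0\<close> and \<open>z = 1\<close> an empty \<open>M\<close> would
    give \<open>- n = 0\<close>.\<close>
  have "M \<noteq> {#}"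
  proof
    assume "M = {#}"
    moreover have "f j (\<lambda>x. 0) = 0" if "j \<in># K" for j
      using linear_functional_zero[of "f j"] assms(2)[of j] KM(2) that by auto
    then have "(\<Sum>j\<in>#K. f j (\<lambda>x. 0)) = 0" by (simp cong: image_mset_cong)
    ultimately show False using eq[of 1 "\<lambda>x. 0"] N(1) by simp
  qed
  moreover have "(\<Sum>c\<in>#M. g c v) = (\<Sum>j\<in>#K. f j v)" for v
  proof -
    have "(\<Sum>c\<in>#M. - g c v) = - (\<Sum>c\<in>#M. g c v)"
      by (induction M) simp_all
    then show ?thesis using eq[of 0 v] by simp
  qed
  ultimately show ?thesis using KM(2,3) by (intro exI[of _ M] exI[of _ K]) simp
qed

section \<open>Derived rules\<close>

text \<open>Implications are coded as pairs, so that order hypotheses and multisets of implications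
  range over the same type.\<close>

fun bimp :: "'p form \<times> 'p form \<Rightarrow> 'p form" where
  "bimp (A, B) = A \<^bold>\<Rightarrow> B"

lemma GAs_W: "GAs (\<Gamma> \<turnstile> \<Delta>) \<Longrightarrow> GAs (add_mset (A \<^bold>\<Rightarrow> B) \<Gamma> \<turnstile> \<Delta>)"
  using GAs.W[of \<Gamma> \<Delta> A B] by simp

lemma GAs_tL: "GAs (\<Gamma> \<turnstile> \<Delta>) \<Longrightarrow> GAs (add_mset \<^bold>t \<Gamma> \<turnstile> \<Delta>)"
  using GAs.tL[of \<Gamma> \<Delta>] by simp

lemma GAs_tR: "GAs (\<Gamma> \<turnstile> \<Delta>) \<Longrightarrow> GAs (\<Gamma> \<turnstile> add_mset \<^bold>t \<Delta>)"
  using GAs.tR[of \<Gamma> \<Delta>] by simp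

lemma GAs_NegL: "GAs (\<Gamma> \<turnstile> add_mset A \<Delta>) \<Longrightarrow> GAs (add_mset (\<^bold>\<not> A) \<Gamma> \<turnstile> \<Delta>)"
  using GAs.NegL[of \<Gamma> A \<Delta>] by simp

lemma GAs_NegR: "GAs (add_mset A \<Gamma> \<turnstile> \<Delta>) \<Longrightarrow> GAs (\<Gamma> \<turnstile> add_mset (\<^bold>\<not> A) \<Delta>)"
  using GAs.NegR[of \<Gamma> A \<Delta>] by simp

lemma GAs_ImpL:
  "GAs (add_mset B \<Gamma> \<turnstile> add_mset A \<Delta>) \<Longrightarrow> GAs (add_mset (A \<^bold>\<rightarrow> B) \<Gamma> \<turnstile> \<Delta>)"
  using GAs.ImpL[of \<Gamma> B A \<Delta>] by simp

lemma GAs_ImpR: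
  "GAs (add_mset A \<Gamma> \<turnstile> add_mset B \<Delta>) \<Longrightarrow> GAs (\<Gamma> \<turnstile> add_mset (A \<^bold>\<rightarrow> B) \<Delta>)"
  using GAs.ImpR[of \<Gamma> A B \<Delta>] by simp

lemma GAs_PlusL:
  "GAs (add_mset A (add_mset B \<Gamma>) \<turnstile> \<Delta>) \<Longrightarrow> GAs (add_mset (A \<^bold>+ B) \<Gamma> \<turnstile> \<Delta>)"
  using GAs.PlusL[of \<Gamma> A B \<Delta>] by simp

lemma GAs_PlusR:
  "GAs (\<Gamma> \<turnstile> add_mset A (add_mset B \<Delta>)) \<Longrightarrow> GAs (\<Gamma> \<turnstile> add_mset (A \<^bold>+ B) \<Delta>)"
  using GAs.PlusR[of \<Gamma> A B \<Delta>] by simp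

lemma GAs_BImpL:
  "GAs (add_mset B (add_mset (B \<^bold>\<Rightarrow> A) \<Gamma>) \<turnstile> add_mset A \<Delta>) \<Longrightarrow>
    GAs (add_mset (A \<^bold>\<Rightarrow> B) \<Gamma> \<turnstile> \<Delta>)"
  using GAs.BImpL[of \<Gamma> B A \<Delta>] by simp

lemma GAs_BImpR:
  "GAs (\<Gamma> \<turnstile> \<Delta>) \<Longrightarrow> GAs (add_mset A \<Gamma> \<turnstile> add_mset B \<Delta>) \<Longrightarrow>
    GAs (\<Gamma> \<turnstile> add_mset (A \<^bold>\<Rightarrow> B) \<Delta>)"
  using GAs.BImpR[of \<Gamma> \<Delta> A B] by simp

lemma GAs_add_both: "GAs (\<Gamma> \<turnstile> \<Delta>) \<Longrightarrow> GAs (add_mset A \<Gamma> \<turnstile> add_mset A \<Delta>)"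
  using GAs.M[OF GAs.ID[of A], of \<Gamma> \<Delta>] by simp

lemma GAs_add_both_cases:
  assumes "GAs (add_mset A \<Gamma> \<turnstile> add_mset A \<Delta>) \<or> GAs (add_mset B \<Gamma> \<turnstile> add_mset B \<Delta>)"
  shows "GAs (add_mset A (add_mset B \<Gamma>) \<turnstile> add_mset A (add_mset B \<Delta>))"
  using assms
proof
  assume "GAs (add_mset A \<Gamma> \<turnstile> add_mset A \<Delta>)"
  from GAs_add_both[OF this, of B] show ?thesis by (simp add: add_mset_commute)
qed (rule GAs_add_both)

lemma GAs_refl: "GAs (\<Gamma> \<turnstile> \<Gamma>)"
  by (induction \<Gamma>) (auto intro: GAs.EMP GAs_add_both)

lemma GAs_weaken:
  "GAs (\<Gamma> \<turnstile> \<Delta>) \<Longrightarrow> GAs (\<Gamma> + image_mset bimp K \<turnstile> \<Delta>)"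
  by (induction K) (auto intro: GAs_W)

text \<open>The left rule also produces \<open>B \<Rightarrow> A\<close>, which (W) discards.
  Semantically, \<open>A \<Rightarrow> B\<close> is at most \<open>B - A\<close>.\<close>

lemma GAs_use_bimp:
  "GAs (add_mset B \<Gamma> \<turnstile> add_mset A \<Delta>) \<Longrightarrow> GAs (add_mset (A \<^bold>\<Rightarrow> B) \<Gamma> \<turnstile> \<Delta>)"
  using GAs_BImpL[of B A \<Gamma> \<Delta>] GAs_W[of "add_mset B \<Gamma>" "add_mset A \<Delta>" B A]
  by (simp add: add_mset_commute)

section \<open>Splitting on the order of two subformulas\<close>

fun subformulas :: "'p form \<Rightarrow> 'p form set" where
  "subformulas (Var p) = {Var p}"
| "subformulas \<^bold>t = {\<^bold>t}"
| "subformulas (\<^bold>\<not> A) = insert (\<^bold>\<not> A) (subformulas A)"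
| "subformulas (A \<^bold>+ B) = insert (A \<^bold>+ B) (subformulas A \<union> subformulas B)"
| "subformulas (A \<^bold>\<rightarrow> B) = insert (A \<^bold>\<rightarrow> B) (subformulas A \<union> subformulas B)"
| "subformulas (A \<^bold>\<Rightarrow> B) = insert (A \<^bold>\<Rightarrow> B) (subformulas A \<union> subformulas B)"

lemma finite_subformulas: "finite (subformulas A)"
  by (induction A) auto

text \<open>The rules decompose both copies of \<open>A\<close> together, leaving its immediate
  subformulas on both sides. One of them contains \<open>X\<close> and falls under the induction
  hypothesis; the other is supplied by (M) and an axiom.\<close>

lemma GAs_add_both_superformula:
  assumes "X \<in> subformulas A" "GAs (add_mset X \<Gamma> \<turnstile> add_mset X \<Delta>)"
  shows "GAs (add_mset A \<Gamma> \<turnstile> add_mset A \<Delta>)"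
  using assms(1)
proof (induction A)
  case (Neg A)
  show ?case
  proof (cases "X = \<^bold>\<not> A")
    case False
    then have "GAs (add_mset A \<Gamma> \<turnstile> add_mset A \<Delta>)" using Neg by auto
    then have "GAs (\<Gamma> \<turnstile> add_mset A (add_mset (\<^bold>\<not> A) \<Delta>))"
      using GAs_NegR[of A \<Gamma> "add_mset A \<Delta>"] by (simp add: add_mset_commute)
    then show ?thesis by (rule GAs_NegL)
  qed (use assms(2) in simp)
next
  case (Plus A B)
  show ?case
  proof (cases "X = A \<^bold>+ B")
    case True
    then show ?thesis using assms(2) by simp
  next
    case False
    then have "GAs (add_mset A \<Gamma> \<turnstile> add_mset A \<Delta>) \<or> GAs (add_mset B \<Gamma> \<turnstile> add_mset B \<Delta>)"
      using Plus by auto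
    then have "GAs (add_mset A (add_mset B \<Gamma>) \<turnstile> add_mset A (add_mset B \<Delta>))"
      by (rule GAs_add_both_cases)
    then show ?thesis by (intro GAs_PlusL GAs_PlusR)
  qed
next
  case (Imp A B)
  show ?case
  proof (cases "X = A \<^bold>\<rightarrow> B")
    case True
    then show ?thesis using assms(2) by simp
  next
    case False
    then have "GAs (add_mset A \<Gamma> \<turnstile> add_mset A \<Delta>) \<or> GAs (add_mset B \<Gamma> \<turnstile> add_mset B \<Delta>)"
      using Imp by auto
    then have "GAs (add_mset A (add_mset B \<Gamma>) \<turnstile> add_mset A (add_mset B \<Delta>))"
      by (rule GAs_add_both_cases)
    then have "GAs (add_mset B \<Gamma> \<turnstile> add_mset A (add_mset (A \<^bold>\<rightarrow> B) \<Delta>))"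
      using GAs_ImpR[of A "add_mset B \<Gamma>" B "add_mset A \<Delta>"] by (simp add: add_mset_commute)
    then show ?thesis by (rule GAs_ImpL)
  qed
next
  case (BImp A B)
  show ?case
  proof (cases "X = A \<^bold>\<Rightarrow> B")
    case True
    then show ?thesis using assms(2) by simp
  next
    case False
    then have "GAs (add_mset A \<Gamma> \<turnstile> add_mset A \<Delta>) \<or> GAs (add_mset B \<Gamma> \<turnstile> add_mset B \<Delta>)"
      using BImp by auto
    then have ab: "GAs (add_mset A (add_mset B \<Gamma>) \<turnstile> add_mset A (add_mset B \<Delta>))"
      by (rule GAs_add_both_cases)
    have r: "GAs (add_mset A (add_mset (A \<^bold>\<Rightarrow> B) \<Gamma>) \<turnstile> add_mset B \<Delta>)"
      using GAs_use_bimp[of B "add_mset A \<Gamma>" A "add_mset B \<Delta>"] ab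
      by (simp add: add_mset_commute)
    \<comment> \<open>In the premise without the right-hand implication, the left rule leaves
      \<open>B \<Rightarrow> A\<close> on the left; using that too brings \<open>A\<close> and
      \<open>B\<close> to both sides.\<close>
    have "GAs (add_mset B (add_mset (B \<^bold>\<Rightarrow> A) \<Gamma>) \<turnstile> add_mset A \<Delta>)"
      using GAs_use_bimp[of A "add_mset B \<Gamma>" B "add_mset A \<Delta>"] ab
      by (simp add: add_mset_commute)
    then have "GAs (add_mset (A \<^bold>\<Rightarrow> B) \<Gamma> \<turnstile> \<Delta>)" by (rule GAs_BImpL)
    then show ?thesis using r by (rule GAs_BImpR)
  qed
qed (use assms(2) in auto)

text \<open>Two applications of the left rule for \<open>A \<^bold>\<Rightarrow> B\<close> restore it and put
  \<open>A\<close> and \<open>B\<close> on both sides.\<close>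

lemma GAs_cancel_subformula:
  assumes mem: "A \<^bold>\<Rightarrow> B \<in># \<Gamma>" and X: "X \<in> subformulas A \<union> subformulas B"
    and der: "GAs (add_mset X \<Gamma> \<turnstile> add_mset X \<Delta>)"
  shows "GAs (\<Gamma> \<turnstile> \<Delta>)"
proof -
  obtain \<Gamma>' where \<Gamma>: "\<Gamma> = add_mset (A \<^bold>\<Rightarrow> B) \<Gamma>'" using mem by (metis mset_add)
  have "GAs (add_mset A \<Gamma> \<turnstile> add_mset A \<Delta>) \<or> GAs (add_mset B \<Gamma> \<turnstile> add_mset B \<Delta>)"
    using X der GAs_add_both_superformula by blast
  then have "GAs (add_mset A (add_mset B \<Gamma>) \<turnstile> add_mset A (add_mset B \<Delta>))"
    by (rule GAs_add_both_cases)
  then have "GAs (add_mset B (add_mset (B \<^bold>\<Rightarrow> A) \<Gamma>') \<turnstile> add_mset A \<Delta>)"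
    using GAs_BImpL[of A B "add_mset B \<Gamma>'" "add_mset A \<Delta>"] by (simp add: \<Gamma> add_mset_commute)
  then show ?thesis unfolding \<Gamma> by (rule GAs_BImpL)
qed

text \<open>A restricted form of cut: only subformulas of the arguments of an implication that stays
  on the left may be cancelled.\<close>

definition cancellable :: "'p form multiset \<Rightarrow> 'p form \<Rightarrow> bool" where
  "cancellable \<Gamma> X \<longleftrightarrow>
    (\<exists>A B. A \<^bold>\<Rightarrow> B \<in># \<Gamma> \<and> X \<in> subformulas A \<union> subformulas B)"

lemma GAs_cancel:
  "cancellable \<Gamma> X \<Longrightarrow> GAs (add_mset X \<Gamma> \<turnstile> add_mset X \<Delta>) \<Longrightarrow> GAs (\<Gamma> \<turnstile> \<Delta>)"
  unfolding cancellable_def using GAs_cancel_subformula by blast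

lemma cancellable_add: "cancellable \<Gamma> X \<Longrightarrow> cancellable (\<Gamma> + \<Gamma>') X"
  unfolding cancellable_def by auto

text \<open>With \<open>C \<Rightarrow> D\<close> put on both sides, the right rule has the first
  hypothesis as one premise. In the other, the left rule turns \<open>C \<Rightarrow> D\<close> into
  \<open>D \<Rightarrow> C\<close> and balances \<open>C\<close> and \<open>D\<close>, which leaves
  the second hypothesis.\<close>

lemma GAs_split_once:
  assumes "cancellable \<Gamma> (C \<^bold>\<Rightarrow> D)"
    and "GAs (add_mset (C \<^bold>\<Rightarrow> D) \<Gamma> \<turnstile> \<Delta>)" "GAs (add_mset (D \<^bold>\<Rightarrow> C) \<Gamma> \<turnstile> \<Delta>)"
  shows "GAs (\<Gamma> \<turnstile> \<Delta>)"
proof (rule GAs_cancel[OF assms(1)])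
  have "GAs (add_mset D (add_mset (D \<^bold>\<Rightarrow> C) (add_mset C \<Gamma>)) \<turnstile> add_mset C (add_mset D \<Delta>))"
    using GAs_add_both[OF GAs_add_both[OF assms(3)], of D C] by (simp add: add_mset_commute)
  then have "GAs (add_mset C (add_mset (C \<^bold>\<Rightarrow> D) \<Gamma>) \<turnstile> add_mset D \<Delta>)"
    using GAs_BImpL[of D C "add_mset C \<Gamma>" "add_mset D \<Delta>"] by (simp add: add_mset_commute)
  then show "GAs (add_mset (C \<^bold>\<Rightarrow> D) \<Gamma> \<turnstile> add_mset (C \<^bold>\<Rightarrow> D) \<Delta>)"
    by (rule GAs_BImpR[OF assms(2)])
qed

text \<open>A single split moves one copy into \<Gamma>, so one of the counts drops; (W) carries the
  other hypothesis over. At count 0 that hypothesis is already the goal.\<close>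

lemma GAs_split:
  assumes "cancellable \<Gamma> (C \<^bold>\<Rightarrow> D)"
    and "GAs (\<Gamma> + replicate_mset a (C \<^bold>\<Rightarrow> D) \<turnstile> \<Delta>)"
    and "GAs (\<Gamma> + replicate_mset b (D \<^bold>\<Rightarrow> C) \<turnstile> \<Delta>)"
  shows "GAs (\<Gamma> \<turnstile> \<Delta>)"
  using assms
proof (induction "a + b" arbitrary: a b \<Gamma> rule: less_induct)
  case less
  show ?case
  proof (cases "a = 0 \<or> b = 0")
    case True
    then show ?thesis using less.prems by auto
  next
    case False
    then obtain a' b' where ab: "a = Suc a'" "b = Suc b'" by (metis not0_implies_Suc)
    have canc: "cancellable (add_mset Y \<Gamma>) (C \<^bold>\<Rightarrow> D)" for Y
      using cancellable_add[OF less.prems(1), of "{#Y#}"] by simp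
    have "GAs (add_mset (C \<^bold>\<Rightarrow> D) \<Gamma> \<turnstile> \<Delta>)"
      by (rule less.hyps[of a' b])
         (use canc less.prems(2) GAs_W[OF less.prems(3), of C D] ab in
          \<open>simp_all add: add_mset_commute\<close>)
    moreover have "GAs (add_mset (D \<^bold>\<Rightarrow> C) \<Gamma> \<turnstile> \<Delta>)"
      by (rule less.hyps[of a b'])
         (use canc less.prems(3) GAs_W[OF less.prems(2), of D C] ab in
          \<open>simp_all add: add_mset_commute\<close>)
    ultimately show ?thesis using GAs_split_once less.prems(1) by blast
  qed
qed

section \<open>Derivability under order hypotheses\<close>

text \<open>A pair \<open>(C, D)\<close> in \<open>H\<close> is the hypothesis that the value of \<open>C\<close> is at most that of \<open>D\<close>:
  under it every copy of \<open>C \<^bold>\<Rightarrow> D\<close> on the left is worth \<open>0\<close>, and otherwise enough copies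
  make the left-hand side arbitrarily small.\<close>

definition GAs_under ::
  "('p form \<times> 'p form) set \<Rightarrow> 'p form multiset \<Rightarrow> 'p form multiset \<Rightarrow> bool" where
  "GAs_under H \<Gamma> \<Delta> \<longleftrightarrow> (\<exists>K. set_mset K \<subseteq> H \<and> GAs (\<Gamma> + image_mset bimp K \<turnstile> \<Delta>))"

lemma GAs_underI: "set_mset K \<subseteq> H \<Longrightarrow> GAs (\<Gamma> + image_mset bimp K \<turnstile> \<Delta>) \<Longrightarrow> GAs_under H \<Gamma> \<Delta>"
  unfolding GAs_under_def by blast

lemma GAs_underE:
  assumes "GAs_under H \<Gamma> \<Delta>"
  obtains K where "set_mset K \<subseteq> H" "GAs (\<Gamma> + image_mset bimp K \<turnstile> \<Delta>)"
  using assms unfolding GAs_under_def by blast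

lemma GAs_under_empty: "GAs_under {} \<Gamma> \<Delta> \<longleftrightarrow> GAs (\<Gamma> \<turnstile> \<Delta>)"
  by (simp add: GAs_under_def)

lemma GAs_imp_under: "GAs (\<Gamma> \<turnstile> \<Delta>) \<Longrightarrow> GAs_under H \<Gamma> \<Delta>"
  by (rule GAs_underI[of "{#}"]) simp_all

text \<open>The free context \<Theta> leaves room for the implications taken from \<open>H\<close>,
  so rules with a left context lift.\<close>

lemma GAs_under_map:
  assumes rule: "\<And>\<Theta>. GAs (\<Gamma>1 + \<Theta> \<turnstile> \<Delta>1) \<Longrightarrow> GAs (\<Gamma> + \<Theta> \<turnstile> \<Delta>)"
    and "GAs_under H \<Gamma>1 \<Delta>1"
  shows "GAs_under H \<Gamma> \<Delta>"
proof -
  obtain K where "set_mset K \<subseteq> H" "GAs (\<Gamma>1 + image_mset bimp K \<turnstile> \<Delta>1)"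
    using assms(2) by (rule GAs_underE)
  then show ?thesis by (intro GAs_underI[of K] rule)
qed

text \<open>The premises may use different hypotheses; (W) brings both to the common multiset
  \<open>K1 + K2\<close>.\<close>

lemma GAs_under_map2:
  assumes rule: "\<And>\<Theta>. GAs (\<Gamma>1 + \<Theta> \<turnstile> \<Delta>1) \<Longrightarrow> GAs (\<Gamma>2 + \<Theta> \<turnstile> \<Delta>2) \<Longrightarrow> GAs (\<Gamma> + \<Theta> \<turnstile> \<Delta>)"
    and "GAs_under H \<Gamma>1 \<Delta>1" "GAs_under H \<Gamma>2 \<Delta>2"
  shows "GAs_under H \<Gamma> \<Delta>"
proof -
  obtain K1 where K1: "set_mset K1 \<subseteq> H" "GAs (\<Gamma>1 + image_mset bimp K1 \<turnstile> \<Delta>1)"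
    using assms(2) by (rule GAs_underE)
  obtain K2 where K2: "set_mset K2 \<subseteq> H" "GAs (\<Gamma>2 + image_mset bimp K2 \<turnstile> \<Delta>2)"
    using assms(3) by (rule GAs_underE)
  have "GAs (\<Gamma>1 + image_mset bimp (K1 + K2) \<turnstile> \<Delta>1)" "GAs (\<Gamma>2 + image_mset bimp (K1 + K2) \<turnstile> \<Delta>2)"
    using GAs_weaken[OF K1(2), of K2] GAs_weaken[OF K2(2), of K1] by (simp_all add: ac_simps)
  then have "GAs (\<Gamma> + image_mset bimp (K1 + K2) \<turnstile> \<Delta>)" by (rule rule)
  then show ?thesis by (rule GAs_underI[rotated]) (use K1(1) K2(1) in simp)
qed

lemma GAs_under_BImpR:
  "GAs_under H \<Gamma> \<Delta> \<Longrightarrow> GAs_under H (add_mset A \<Gamma>) (add_mset B \<Delta>) \<Longrightarrow>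
    GAs_under H \<Gamma> (add_mset (A \<^bold>\<Rightarrow> B) \<Delta>)"
  by (rule GAs_under_map2[of \<Gamma> \<Delta> "add_mset A \<Gamma>" "add_mset B \<Delta>"]) (simp_all add: GAs_BImpR)

text \<open>One more copy of \<open>A \<Rightarrow> B\<close> is charged to \<open>K\<close> and
  spent on exchanging \<open>B\<close> for \<open>A\<close>.\<close>

lemma GAs_under_hypothesis:
  assumes "(A, B) \<in> H" "GAs_under H (add_mset B \<Gamma>) (add_mset A \<Delta>)"
  shows "GAs_under H \<Gamma> \<Delta>"
proof -
  obtain K where K: "set_mset K \<subseteq> H" "GAs (add_mset B \<Gamma> + image_mset bimp K \<turnstile> add_mset A \<Delta>)"
    using assms(2) by (rule GAs_underE)
  then have "GAs (\<Gamma> + image_mset bimp (add_mset (A, B) K) \<turnstile> \<Delta>)"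
    using GAs_use_bimp[of B "\<Gamma> + image_mset bimp K" A \<Delta>] by simp
  then show ?thesis by (rule GAs_underI[rotated]) (use K(1) assms(1) in simp)
qed

lemma GAs_under_hypotheses:
  assumes "set_mset K \<subseteq> H" "GAs_under H (\<Gamma> + image_mset snd K) (\<Delta> + image_mset fst K)"
  shows "GAs_under H \<Gamma> \<Delta>"
  using assms
proof (induction K)
  case (add x K)
  then show ?case
    using GAs_under_hypothesis[of "fst x" "snd x" H "\<Gamma> + image_mset snd K" "\<Delta> + image_mset fst K"]
    by simp
qed simp

lemma GAs_under_C:
  assumes "n > 0" "GAs_under H (repeat_mset n \<Gamma>) (repeat_mset n \<Delta>)"
  shows "GAs_under H \<Gamma> \<Delta>"
proof -
  obtain K where K: "set_mset K \<subseteq> H" "GAs (repeat_mset n \<Gamma> + image_mset bimp K \<turnstile> repeat_mset n \<Delta>)"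
    using assms(2) by (rule GAs_underE)
  obtain m where n: "n = Suc m" using assms(1) by (cases n) auto
  have rep: "repeat_mset k (image_mset bimp K) = image_mset bimp (repeat_mset k K)" for k
    by (induction k) auto
  \<comment> \<open>Rule (C) needs the hypotheses in \<open>n\<close> copies as well; (W) adds the
    missing \<open>m = n - 1\<close>.\<close>
  have "GAs (repeat_mset n (\<Gamma> + image_mset bimp K) \<turnstile> repeat_mset n \<Delta>)"
    using GAs_weaken[OF K(2), of "repeat_mset m K"]
    by (simp add: n rep repeat_mset_distrib2 ac_simps)
  then have "GAs (\<Gamma> + image_mset bimp K \<turnstile> \<Delta>)" by (rule GAs.C[OF assms(1)])
  then show ?thesis by (rule GAs_underI[OF K(1)])
qed

lemma mset_insert_split:
  "set_mset K \<subseteq> insert x H \<Longrightarrow> \<exists>n K'. K = replicate_mset n x + K' \<and> set_mset K' \<subseteq> H"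
proof (induction K)
  case (add y K)
  then obtain n K' where K: "K = replicate_mset n x + K'" "set_mset K' \<subseteq> H" by auto
  show ?case
  proof (cases "y = x")
    case True
    then show ?thesis using K by (intro exI[of _ "Suc n"] exI[of _ K']) simp
  next
    case False
    then show ?thesis using K add.prems by (intro exI[of _ n] exI[of _ "add_mset y K'"]) simp
  qed
qed simp

lemma GAs_under_insertE:
  assumes "GAs_under (insert (C, D) H) \<Gamma> \<Delta>"
  obtains n K where "set_mset K \<subseteq> H"
    "GAs (\<Gamma> + image_mset bimp K + replicate_mset n (C \<^bold>\<Rightarrow> D) \<turnstile> \<Delta>)"
proof -
  obtain N where N: "set_mset N \<subseteq> insert (C, D) H" "GAs (\<Gamma> + image_mset bimp N \<turnstile> \<Delta>)"
    using assms by (rule GAs_underE)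
  obtain n K where "N = replicate_mset n (C, D) + K" "set_mset K \<subseteq> H"
    using mset_insert_split[OF N(1)] by blast
  then show ?thesis using that[of K n] N(2) by (simp add: ac_simps)
qed

text \<open>The hypotheses from \<open>H\<close> used in either branch are first made equal by
  weakening; the remaining copies of the two opposite implications are then removed by
  \<open>GAs_split\<close>.\<close>

lemma GAs_under_split:
  assumes canc: "cancellable \<Gamma> (C \<^bold>\<Rightarrow> D)"
    and "GAs_under (insert (C, D) H) \<Gamma> \<Delta>" "GAs_under (insert (D, C) H) \<Gamma> \<Delta>"
  shows "GAs_under H \<Gamma> \<Delta>"
proof -
  obtain a K1 where 1: "set_mset K1 \<subseteq> H"
    "GAs (\<Gamma> + image_mset bimp K1 + replicate_mset a (C \<^bold>\<Rightarrow> D) \<turnstile> \<Delta>)"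
    using assms(2) by (rule GAs_under_insertE)
  obtain b K2 where 2: "set_mset K2 \<subseteq> H"
    "GAs (\<Gamma> + image_mset bimp K2 + replicate_mset b (D \<^bold>\<Rightarrow> C) \<turnstile> \<Delta>)"
    using assms(3) by (rule GAs_under_insertE)
  let ?\<Gamma> = "\<Gamma> + image_mset bimp (K1 + K2)"
  have "GAs (?\<Gamma> \<turnstile> \<Delta>)"
  proof (rule GAs_split[of _ C D a _ b])
    show "cancellable ?\<Gamma> (C \<^bold>\<Rightarrow> D)" using canc by (rule cancellable_add)
    show "GAs (?\<Gamma> + replicate_mset a (C \<^bold>\<Rightarrow> D) \<turnstile> \<Delta>)"
      using GAs_weaken[OF 1(2), of K2] by (simp add: ac_simps)
    show "GAs (?\<Gamma> + replicate_mset b (D \<^bold>\<Rightarrow> C) \<turnstile> \<Delta>)"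
      using GAs_weaken[OF 2(2), of K1] by (simp add: ac_simps)
  qed
  then show ?thesis by (rule GAs_underI[rotated]) (use 1(1) 2(1) in simp)
qed

lemma GAs_under_split_all:
  assumes "finite Q" "\<And>C D. (C, D) \<in> Q \<Longrightarrow> cancellable \<Gamma> (C \<^bold>\<Rightarrow> D)"
    and complete: "\<And>H. finite H \<Longrightarrow> H \<subseteq> Q \<union> Q\<inverse> \<Longrightarrow> Q \<subseteq> H \<union> H\<inverse> \<Longrightarrow> GAs_under H \<Gamma> \<Delta>"
  shows "GAs (\<Gamma> \<turnstile> \<Delta>)"
proof -
  \<comment> \<open>\<open>R\<close> holds the pairs not yet decided; each induction step splits on
    one of them, and \<open>R = Q\<close> with \<open>H = {}\<close> is the goal.\<close>
  have "GAs_under H \<Gamma> \<Delta>"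
    if "finite R" "R \<subseteq> Q" "finite H" "H \<subseteq> Q \<union> Q\<inverse>" "Q - R \<subseteq> H \<union> H\<inverse>" for R H
    using that
  proof (induction R arbitrary: H rule: finite_induct)
    case empty
    then show ?case using complete by simp
  next
    case (insert x R)
    obtain C D where x: "x = (C, D)" by force
    show ?case
    proof (rule GAs_under_split[of _ C D])
      show "cancellable \<Gamma> (C \<^bold>\<Rightarrow> D)" using assms(2) insert.prems x by blast
      show "GAs_under (insert (C, D) H) \<Gamma> \<Delta>" "GAs_under (insert (D, C) H) \<Gamma> \<Delta>"
        using insert.prems x by (auto intro!: insert.IH)
    qed
  qed
  from this[of Q "{}"] have "GAs_under {} \<Gamma> \<Delta>" using assms(1) by auto
  then show ?thesis by (simp add: GAs_under_empty)
qed

section \<open>Decomposition of sequents\<close>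

definition flat :: "'p form \<Rightarrow> bool" where
  "flat A \<longleftrightarrow> A \<in> range Var \<or> A \<in> range bimp"

text \<open>Leaves variables and \<open>\<Rightarrow>\<close> free, so that both
  \<open>val v\<close> and \<open>linear_val H v\<close> are instances.\<close>

definition group_value :: "('p form \<Rightarrow> rat) \<Rightarrow> bool" where
  "group_value e \<longleftrightarrow> e \<^bold>t = 0 \<and> (\<forall>A. e (\<^bold>\<not> A) = - e A) \<and>
     (\<forall>A B. e (A \<^bold>+ B) = e A + e B) \<and> (\<forall>A B. e (A \<^bold>\<rightarrow> B) = e B - e A)"

abbreviation total :: "('p form \<Rightarrow> rat) \<Rightarrow> 'p form multiset \<Rightarrow> rat" where
  "total e \<Gamma> \<equiv> (\<Sum>A\<in>#\<Gamma>. e A)"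

text \<open>Each symbol counts 1, so removing \<open>t\<close> or an outermost connective lowers the
  total.\<close>

primrec weight :: "'p form \<Rightarrow> nat" where
  "weight (Var p) = 1"
| "weight \<^bold>t = 1"
| "weight (\<^bold>\<not> A) = weight A + 1"
| "weight (A \<^bold>+ B) = weight A + weight B + 1"
| "weight (A \<^bold>\<rightarrow> B) = weight A + weight B + 1"
| "weight (A \<^bold>\<Rightarrow> B) = weight A + weight B + 1"

lemma not_flat_cases:
  assumes "\<not> flat A"
  obtains "A = \<^bold>t" | B where "A = \<^bold>\<not> B" | B C where "A = B \<^bold>+ C" | B C where "A = B \<^bold>\<rightarrow> C"
proof (cases A)
  case (BImp B C)
  then have "A = bimp (B, C)" by simp
  then show ?thesis using assms unfolding flat_def by blast
qed (use assms that in \<open>auto simp: flat_def\<close>)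

text \<open>The rules other than those for \<open>\<^bold>\<Rightarrow>\<close> do not change the difference of the two sides, so
  that any property \<open>P\<close> of this difference passes to their premises.\<close>

lemma decomposition_induct:
  fixes e :: "'w \<Rightarrow> 'p form \<Rightarrow> rat"
  assumes e: "\<And>w. group_value (e w)"
    and rules: "\<And>\<Gamma> \<Delta>. D \<Gamma> \<Delta> \<Longrightarrow> D (add_mset \<^bold>t \<Gamma>) \<Delta>"
      "\<And>\<Gamma> \<Delta>. D \<Gamma> \<Delta> \<Longrightarrow> D \<Gamma> (add_mset \<^bold>t \<Delta>)"
      "\<And>\<Gamma> \<Delta> A. D \<Gamma> (add_mset A \<Delta>) \<Longrightarrow> D (add_mset (\<^bold>\<not> A) \<Gamma>) \<Delta>"
      "\<And>\<Gamma> \<Delta> A. D (add_mset A \<Gamma>) \<Delta> \<Longrightarrow> D \<Gamma> (add_mset (\<^bold>\<not> A) \<Delta>)"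
      "\<And>\<Gamma> \<Delta> A B. D (add_mset A (add_mset B \<Gamma>)) \<Delta> \<Longrightarrow> D (add_mset (A \<^bold>+ B) \<Gamma>) \<Delta>"
      "\<And>\<Gamma> \<Delta> A B. D \<Gamma> (add_mset A (add_mset B \<Delta>)) \<Longrightarrow> D \<Gamma> (add_mset (A \<^bold>+ B) \<Delta>)"
      "\<And>\<Gamma> \<Delta> A B. D (add_mset B \<Gamma>) (add_mset A \<Delta>) \<Longrightarrow> D (add_mset (A \<^bold>\<rightarrow> B) \<Gamma>) \<Delta>"
      "\<And>\<Gamma> \<Delta> A B. D (add_mset A \<Gamma>) (add_mset B \<Delta>) \<Longrightarrow> D \<Gamma> (add_mset (A \<^bold>\<rightarrow> B) \<Delta>)"
    and flat: "\<And>\<Gamma> \<Delta>. \<forall>A\<in>#\<Gamma> + \<Delta>. flat A \<Longrightarrow>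
      (\<And>\<Gamma>' \<Delta>'. (\<Sum>A\<in>#\<Gamma>' + \<Delta>'. weight A) < (\<Sum>A\<in>#\<Gamma> + \<Delta>. weight A) \<Longrightarrow>
        P (\<lambda>w. total (e w) \<Delta>' - total (e w) \<Gamma>') \<Longrightarrow> D \<Gamma>' \<Delta>') \<Longrightarrow>
      P (\<lambda>w. total (e w) \<Delta> - total (e w) \<Gamma>) \<Longrightarrow> D \<Gamma> \<Delta>"
    and "P (\<lambda>w. total (e w) \<Delta> - total (e w) \<Gamma>)"
  shows "D \<Gamma> \<Delta>"
  using assms(11)
\<comment> \<open>Total weight is the measure because the flat case must reach lighter sequents that
  need not be flat.\<close>
proof (induction "\<Sum>A\<in>#\<Gamma> + \<Delta>. weight A" arbitrary: \<Gamma> \<Delta> rule: less_induct)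
  case less
  have e_simps: "e w \<^bold>t = 0" "e w (\<^bold>\<not> A) = - e w A" "e w (A \<^bold>+ B) = e w A + e w B"
    "e w (A \<^bold>\<rightarrow> B) = e w B - e w A" for w A B
    using e unfolding group_value_def by blast+
  consider (flat) "\<forall>A\<in>#\<Gamma> + \<Delta>. flat A" | (left) A \<Gamma>' where "\<Gamma> = add_mset A \<Gamma>'" "\<not> flat A"
    | (right) A \<Delta>' where "\<Delta> = add_mset A \<Delta>'" "\<not> flat A"
    by (metis mset_add union_iff)
  then show ?case
  proof cases
    case flat
    then show ?thesis using less assms(10) by blast
  next
    case left
    from left(2) show ?thesis
    proof (cases rule: not_flat_cases)
      case 1
      have "D \<Gamma>' \<Delta>" by (rule less.hyps) (use less.prems left 1 e_simps in simp_all)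
      then show ?thesis using rules(1) left 1 by simp
    next
      case (2 B)
      have "D \<Gamma>' (add_mset B \<Delta>)"
        by (rule less.hyps) (use less.prems left 2 e_simps in \<open>simp_all add: algebra_simps\<close>)
      then show ?thesis using rules(3) left 2 by simp
    next
      case (3 B C)
      have "D (add_mset B (add_mset C \<Gamma>')) \<Delta>"
        by (rule less.hyps) (use less.prems left 3 e_simps in \<open>simp_all add: algebra_simps\<close>)
      then show ?thesis using rules(5) left 3 by simp
    next
      case (4 B C)
      have "D (add_mset C \<Gamma>') (add_mset B \<Delta>)"
        by (rule less.hyps) (use less.prems left 4 e_simps in \<open>simp_all add: algebra_simps\<close>)
      then show ?thesis using rules(7) left 4 by simp
    qed
  next
    case right
    from right(2) show ?thesis
    proof (cases rule: not_flat_cases)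
      case 1
      have "D \<Gamma> \<Delta>'" by (rule less.hyps) (use less.prems right 1 e_simps in simp_all)
      then show ?thesis using rules(2) right 1 by simp
    next
      case (2 B)
      have "D (add_mset B \<Gamma>) \<Delta>'"
        by (rule less.hyps) (use less.prems right 2 e_simps in \<open>simp_all add: algebra_simps\<close>)
      then show ?thesis using rules(4) right 2 by simp
    next
      case (3 B C)
      have "D \<Gamma> (add_mset B (add_mset C \<Delta>'))"
        by (rule less.hyps) (use less.prems right 3 e_simps in \<open>simp_all add: algebra_simps\<close>)
      then show ?thesis using rules(6) right 3 by simp
    next
      case (4 B C)
      have "D (add_mset B \<Gamma>) (add_mset C \<Delta>')"
        by (rule less.hyps) (use less.prems right 4 e_simps in \<open>simp_all add: algebra_simps\<close>)
      then show ?thesis using rules(8) right 4 by simp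
    qed
  qed
qed

section \<open>Values of formulas\<close>

primrec val :: "('p \<Rightarrow> rat) \<Rightarrow> 'p form \<Rightarrow> rat" where
  "val v (Var p) = v p"
| "val v \<^bold>t = 0"
| "val v (\<^bold>\<not> A) = - val v A"
| "val v (A \<^bold>+ B) = val v A + val v B"
| "val v (A \<^bold>\<rightarrow> B) = val v B - val v A"
| "val v (A \<^bold>\<Rightarrow> B) = min 0 (val v B - val v A)"

text \<open>The linear map with which \<^term>\<open>val\<close> coincides on the cone of the valuations that satisfy
  the order hypotheses \<open>H\<close>.\<close>

primrec linear_val :: "('p form \<times> 'p form) set \<Rightarrow> ('p \<Rightarrow> rat) \<Rightarrow> 'p form \<Rightarrow> rat" where
  "linear_val H v (Var p) = v p"
| "linear_val H v \<^bold>t = 0"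
| "linear_val H v (\<^bold>\<not> A) = - linear_val H v A"
| "linear_val H v (A \<^bold>+ B) = linear_val H v A + linear_val H v B"
| "linear_val H v (A \<^bold>\<rightarrow> B) = linear_val H v B - linear_val H v A"
| "linear_val H v (A \<^bold>\<Rightarrow> B) = (if (A, B) \<in> H then 0 else linear_val H v B - linear_val H v A)"

definition decided :: "('p form \<times> 'p form) set \<Rightarrow> 'p form \<Rightarrow> bool" where
  "decided H A \<longleftrightarrow> (\<forall>E F. E \<^bold>\<Rightarrow> F \<in> subformulas A \<longrightarrow> (E, F) \<in> H \<or> (F, E) \<in> H)"

lemma decided_simps [simp]:
  "decided H (Var p)"
  "decided H \<^bold>t"
  "decided H (\<^bold>\<not> A) \<longleftrightarrow> decided H A"
  "decided H (A \<^bold>+ B) \<longleftrightarrow> decided H A \<and> decided H B"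
  "decided H (A \<^bold>\<rightarrow> B) \<longleftrightarrow> decided H A \<and> decided H B"
  "decided H (A \<^bold>\<Rightarrow> B) \<longleftrightarrow> decided H A \<and> decided H B \<and> ((A, B) \<in> H \<or> (B, A) \<in> H)"
  unfolding decided_def by auto

lemma group_value_val: "group_value (val v)"
  by (simp add: group_value_def)

lemma group_value_linear_val: "group_value (linear_val H v)"
  by (simp add: group_value_def)

lemma valuation_val: "valuation (val v)"
  by (simp add: valuation_def)

lemma linear_functional_linear_val: "linear_functional (\<lambda>v. linear_val H v A)"
  by (induction A) (simp_all add: linear_functional_def algebra_simps)

lemma linear_functional_total: "linear_functional (\<lambda>v. total (linear_val H v) \<Gamma>)"
  by (rule linear_functional_sum_mset) (rule linear_functional_linear_val)

text \<open>If \<open>(A, B) \<in> H\<close>, the minimum is 0; otherwise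
  \<open>(B, A) \<in> H\<close>, and the minimum is the difference.\<close>

lemma linear_val_eq_val:
  assumes "\<And>E F. (E, F) \<in> H \<Longrightarrow> linear_val H v E \<le> linear_val H v F"
  shows "decided H A \<Longrightarrow> linear_val H v A = val v A"
proof (induction A)
  case (BImp A B)
  then have "linear_val H v A = val v A" "linear_val H v B = val v B" "(A, B) \<in> H \<or> (B, A) \<in> H"
    by simp_all
  then show ?case using assms[of A B] assms[of B A] by auto
qed simp_all

text \<open>Indicator assignments read off multiplicities, so linear forms determine multisets of
  variables.\<close>

lemma total_linear_val_indicator:
  assumes "\<forall>B\<in>#\<Gamma>. B \<in> range Var"
  shows "total (linear_val H (\<lambda>p. if Var p = A then 1 else 0)) \<Gamma> = of_nat (count \<Gamma> A)"
  using assms by (induction \<Gamma>) auto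

lemma mem_flat_cases:
  assumes "\<forall>A\<in>#\<Gamma>. flat A"
  obtains "\<forall>A\<in>#\<Gamma>. A \<in> range Var" | E F \<Gamma>' where "\<Gamma> = add_mset (E \<^bold>\<Rightarrow> F) \<Gamma>'"
proof (cases "\<forall>A\<in>#\<Gamma>. A \<in> range Var")
  case False
  then obtain A where "A \<in># \<Gamma>" "A \<in> range bimp" using assms unfolding flat_def by blast
  moreover from this obtain E F where "A = E \<^bold>\<Rightarrow> F" by force
  ultimately show ?thesis using that(2) by (metis mset_add)
qed (rule that)

text \<open>Decomposition follows \<open>linear_val\<close>: an implication vanishes or becomes a
  difference as \<open>H\<close> prescribes. When only variables remain, equal linear forms mean
  equal multisets.\<close>

lemma GAs_under_linear_equality:
  assumes "\<forall>A\<in>#\<Gamma> + \<Delta>. decided H A"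
    and "\<And>v. total (linear_val H v) \<Gamma> = total (linear_val H v) \<Delta>"
  shows "GAs_under H \<Gamma> \<Delta>"
proof -
  \<comment> \<open>The induction transports only the difference of the sides, so decidedness is
    carried inside \<open>D\<close>.\<close>
  define D where "D \<Gamma> \<Delta> \<longleftrightarrow> ((\<forall>A\<in>#\<Gamma> + \<Delta>. decided H A) \<longrightarrow> GAs_under H \<Gamma> \<Delta>)" for \<Gamma> \<Delta>
  have "D \<Gamma> \<Delta>"
  proof (rule decomposition_induct[where e = "linear_val H" and P = "\<lambda>d. \<forall>v. d v = 0"])
    show "group_value (linear_val H v)" for v by (rule group_value_linear_val)
    show "D (add_mset \<^bold>t \<Gamma>) \<Delta>" if "D \<Gamma> \<Delta>" for \<Gamma> \<Delta>
      using that GAs_under_map[of \<Gamma> \<Delta> "add_mset \<^bold>t \<Gamma>" \<Delta> H] by (simp add: D_def GAs_tL)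
    show "D \<Gamma> (add_mset \<^bold>t \<Delta>)" if "D \<Gamma> \<Delta>" for \<Gamma> \<Delta>
      using that GAs_under_map[of \<Gamma> \<Delta> \<Gamma> "add_mset \<^bold>t \<Delta>" H] by (simp add: D_def GAs_tR)
    show "D (add_mset (\<^bold>\<not> A) \<Gamma>) \<Delta>" if "D \<Gamma> (add_mset A \<Delta>)" for \<Gamma> \<Delta> A
      using that GAs_under_map[of \<Gamma> "add_mset A \<Delta>" "add_mset (\<^bold>\<not> A) \<Gamma>" \<Delta> H]
      by (simp add: D_def GAs_NegL)
    show "D \<Gamma> (add_mset (\<^bold>\<not> A) \<Delta>)" if "D (add_mset A \<Gamma>) \<Delta>" for \<Gamma> \<Delta> A
      using that GAs_under_map[of "add_mset A \<Gamma>" \<Delta> \<Gamma> "add_mset (\<^bold>\<not> A) \<Delta>" H]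
      by (simp add: D_def GAs_NegR)
    show "D (add_mset (A \<^bold>+ B) \<Gamma>) \<Delta>" if "D (add_mset A (add_mset B \<Gamma>)) \<Delta>" for \<Gamma> \<Delta> A B
      using that GAs_under_map[of "add_mset A (add_mset B \<Gamma>)" \<Delta> "add_mset (A \<^bold>+ B) \<Gamma>" \<Delta> H]
      by (simp add: D_def GAs_PlusL)
    show "D \<Gamma> (add_mset (A \<^bold>+ B) \<Delta>)" if "D \<Gamma> (add_mset A (add_mset B \<Delta>))" for \<Gamma> \<Delta> A B
      using that GAs_under_map[of \<Gamma> "add_mset A (add_mset B \<Delta>)" \<Gamma> "add_mset (A \<^bold>+ B) \<Delta>" H]
      by (simp add: D_def GAs_PlusR)
    show "D (add_mset (A \<^bold>\<rightarrow> B) \<Gamma>) \<Delta>" if "D (add_mset B \<Gamma>) (add_mset A \<Delta>)" for \<Gamma> \<Delta> A B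
      using that GAs_under_map[of "add_mset B \<Gamma>" "add_mset A \<Delta>" "add_mset (A \<^bold>\<rightarrow> B) \<Gamma>" \<Delta> H]
      by (simp add: D_def GAs_ImpL)
    show "D \<Gamma> (add_mset (A \<^bold>\<rightarrow> B) \<Delta>)" if "D (add_mset A \<Gamma>) (add_mset B \<Delta>)" for \<Gamma> \<Delta> A B
      using that GAs_under_map[of "add_mset A \<Gamma>" "add_mset B \<Delta>" \<Gamma> "add_mset (A \<^bold>\<rightarrow> B) \<Delta>" H]
      by (simp add: D_def GAs_ImpR)
  next
    fix \<Gamma> \<Delta> :: "'a form multiset"
    assume flat: "\<forall>A\<in>#\<Gamma> + \<Delta>. flat A"
      and IH: "\<And>\<Gamma>' \<Delta>'. (\<Sum>A\<in>#\<Gamma>' + \<Delta>'. weight A) < (\<Sum>A\<in>#\<Gamma> + \<Delta>. weight A) \<Longrightarrow>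
        \<forall>v. total (linear_val H v) \<Delta>' - total (linear_val H v) \<Gamma>' = 0 \<Longrightarrow> D \<Gamma>' \<Delta>'"
      and eq: "\<forall>v. total (linear_val H v) \<Delta> - total (linear_val H v) \<Gamma> = 0"
    show "D \<Gamma> \<Delta>" unfolding D_def
    proof
      assume dec: "\<forall>A\<in>#\<Gamma> + \<Delta>. decided H A"
      have "\<forall>A\<in>#\<Gamma>. flat A" "\<forall>A\<in>#\<Delta>. flat A" using flat by auto
      then consider (vars) "\<forall>A\<in>#\<Gamma>. A \<in> range Var" "\<forall>A\<in>#\<Delta>. A \<in> range Var"
        | (left) E F \<Gamma>' where "\<Gamma> = add_mset (E \<^bold>\<Rightarrow> F) \<Gamma>'"
        | (right) E F \<Delta>' where "\<Delta> = add_mset (E \<^bold>\<Rightarrow> F) \<Delta>'"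
        using mem_flat_cases by metis
      then show "GAs_under H \<Gamma> \<Delta>"
      proof cases
        case vars
        have "count \<Gamma> A = count \<Delta> A" for A
          using eq[rule_format, of "\<lambda>p. if Var p = A then 1 else 0"] vars
          by (simp add: total_linear_val_indicator)
        then have "\<Gamma> = \<Delta>" by (rule multiset_eqI)
        then show ?thesis by (simp add: GAs_imp_under GAs_refl)
      next
        case left
        show ?thesis
        proof (cases "(E, F) \<in> H")
          case True
          have "D \<Gamma>' \<Delta>" by (rule IH) (use eq left True in simp_all)
          then have "GAs_under H \<Gamma>' \<Delta>" using dec left by (simp add: D_def)
          then show ?thesis
            by (rule GAs_under_map[rotated]) (simp add: left GAs_W)
        next
          case False
          have "D (add_mset F \<Gamma>') (add_mset E \<Delta>)"
            by (rule IH) (use eq left False in \<open>simp_all add: algebra_simps\<close>)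
          then have "GAs_under H (add_mset F \<Gamma>') (add_mset E \<Delta>)" using dec left by (simp add: D_def)
          then show ?thesis
            by (rule GAs_under_map[rotated]) (simp add: left GAs_use_bimp)
        qed
      next
        case right
        show ?thesis
        proof (cases "(E, F) \<in> H")
          case True
          have "D \<Gamma> \<Delta>'" by (rule IH) (use eq right True in simp_all)
          then have d: "GAs_under H \<Gamma> \<Delta>'" using dec right by (simp add: D_def)
          \<comment> \<open>The second premise of the right rule follows from the first:
            \<open>E\<close> and \<open>F\<close> are added to both sides, then one of each is
            removed by \<open>(E, F) \<in> H\<close>.\<close>
          then have "GAs_under H (add_mset F (add_mset E \<Gamma>)) (add_mset E (add_mset F \<Delta>'))"
            by (rule GAs_under_map[rotated])
               (simp add: add_mset_commute[of E F] GAs_add_both)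
          then have "GAs_under H (add_mset E \<Gamma>) (add_mset F \<Delta>')"
            by (rule GAs_under_hypothesis[OF True])
          with d show ?thesis unfolding right by (rule GAs_under_BImpR)
        next
          case False
          \<comment> \<open>Here the premise with \<open>E\<close> and \<open>F\<close> comes from
            induction, and the opposite hypothesis reduces the other premise to it.\<close>
          then have FE: "(F, E) \<in> H" using dec right by simp
          have "D (add_mset E \<Gamma>) (add_mset F \<Delta>')"
            by (rule IH) (use eq right False in \<open>simp_all add: algebra_simps\<close>)
          then have d: "GAs_under H (add_mset E \<Gamma>) (add_mset F \<Delta>')"
            using dec right by (simp add: D_def)
          then have "GAs_under H \<Gamma> \<Delta>'" by (rule GAs_under_hypothesis[OF FE])
          then show ?thesis using d unfolding right by (rule GAs_under_BImpR)
        qed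
      qed
    qed
  next
    show "\<forall>v. total (linear_val H v) \<Delta> - total (linear_val H v) \<Gamma> = 0"
      using assms(2) by simp
  qed
  then show ?thesis using assms(1) by (simp add: D_def)
qed

section \<open>Completeness\<close>

lemma subformulas_self: "A \<in> subformulas A"
  by (cases A) simp_all

lemma subformulas_trans: "B \<in> subformulas A \<Longrightarrow> subformulas B \<subseteq> subformulas A"
  by (induction A) auto

section \<open>Selecting outermost implications on the left\<close>

lemma GAs_use_bimps:
  "GAs (\<Gamma> + image_mset snd K \<turnstile> \<Delta> + image_mset fst K) \<Longrightarrow>
    GAs (\<Gamma> + image_mset bimp K \<turnstile> \<Delta>)"
proof (induction K arbitrary: \<Gamma> \<Delta>)
  case (add x K)
  obtain A B where x: "x = (A, B)" by force
  have "GAs (add_mset B \<Gamma> + image_mset bimp K \<turnstile> add_mset A \<Delta>)"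
    by (rule add.IH) (use add.prems x in simp)
  then show ?case using GAs_use_bimp[of B "\<Gamma> + image_mset bimp K" A \<Delta>] by (simp add: x)
qed simp

lemma GAs_use_some_bimps:
  assumes "K \<subseteq># Xs" "GAs (\<Gamma> + image_mset snd K \<turnstile> \<Delta> + image_mset fst K)"
  shows "GAs (\<Gamma> + image_mset bimp Xs \<turnstile> \<Delta>)"
proof -
  have "Xs = K + (Xs - K)" using assms(1) by simp
  then have "image_mset bimp Xs = image_mset bimp K + image_mset bimp (Xs - K)"
    by (metis image_mset_union)
  then show ?thesis
    using GAs_weaken[OF GAs_use_bimps[OF assms(2)], of "Xs - K"] by (simp add: ac_simps)
qed

text \<open>Each copy of the sequent makes its own selection. \<Theta> and \<Psi> hold one copy
  aside while the induction treats the others.\<close>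

lemma GAs_use_choices:
  assumes "\<And>c. c \<in># M \<Longrightarrow> ch c \<subseteq># Xs"
    and "GAs ((\<Sum>c\<in>#M. \<Gamma> + image_mset snd (ch c)) + \<Theta> \<turnstile>
      (\<Sum>c\<in>#M. \<Delta> + image_mset fst (ch c)) + \<Psi>)"
  shows "GAs (repeat_mset (size M) (\<Gamma> + image_mset bimp Xs) + \<Theta> \<turnstile> repeat_mset (size M) \<Delta> + \<Psi>)"
  using assms
proof (induction M arbitrary: \<Theta> \<Psi>)
  case (add c M)
  let ?R = "repeat_mset (size M) (\<Gamma> + image_mset bimp Xs)"
  have "GAs (?R + (\<Gamma> + image_mset snd (ch c) + \<Theta>) \<turnstile>
      repeat_mset (size M) \<Delta> + (\<Delta> + image_mset fst (ch c) + \<Psi>))"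
    by (rule add.IH) (use add.prems in \<open>simp_all add: ac_simps\<close>)
  then have "GAs ((?R + \<Gamma> + \<Theta>) + image_mset snd (ch c) \<turnstile>
      (repeat_mset (size M) \<Delta> + \<Delta> + \<Psi>) + image_mset fst (ch c))"
    by (simp add: ac_simps)
  moreover have "ch c \<subseteq># Xs" using add.prems(1) by simp
  ultimately have "GAs ((?R + \<Gamma> + \<Theta>) + image_mset bimp Xs \<turnstile> repeat_mset (size M) \<Delta> + \<Delta> + \<Psi>)"
    by (rule GAs_use_some_bimps[rotated])
  then show ?case by (simp add: ac_simps)
qed simp

lemma total_sum_mset: "total e (\<Sum>c\<in>#M. h c) = (\<Sum>c\<in>#M. total e (h c))"
  by (induction M) simp_all

lemma sum_mset_min_0:
  fixes h :: "'i \<Rightarrow> rat"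
  shows "(\<Sum>x\<in>#M. min 0 (h x)) = (\<Sum>x\<in>#filter_mset (\<lambda>x. h x < 0) M. h x)"
  by (induction M) auto

lemma sum_mset_rat_diff:
  fixes f g :: "'i \<Rightarrow> rat"
  shows "(\<Sum>x\<in>#M. f x - g x) = (\<Sum>x\<in>#M. f x) - (\<Sum>x\<in>#M. g x)"
  by (induction M) simp_all

lemma total_bimp: "total (val v) (image_mset bimp Xs) = (\<Sum>x\<in>#Xs. min 0 (val v (snd x) - val v (fst x)))"
  by (induction Xs) auto

text \<open>For each valuation compatible with \<open>H\<close>, deleting some of the outermost implications and
  replacing the others \<open>A \<^bold>\<Rightarrow> B\<close> by \<open>B\<close> on the left and \<open>A\<close> on the right yields a sequent
  that holds there. By Farkas' lemma, a sum of such sequents follows linearly from \<open>H\<close>.\<close>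

lemma GAs_under_complete_orders:
  assumes vars: "\<forall>A\<in>#\<Gamma>. A \<in> range Var" "\<forall>A\<in>#\<Delta>. A \<in> range Var"
    and valid: "\<And>v. total (val v) (\<Gamma> + image_mset bimp Xs) \<le> total (val v) \<Delta>"
    and "finite H"
    and dec: "\<And>A B. (A, B) \<in># Xs \<Longrightarrow> decided H A \<and> decided H B"
      "\<And>C D. (C, D) \<in> H \<Longrightarrow> decided H C \<and> decided H D"
  shows "GAs_under H (\<Gamma> + image_mset bimp Xs) \<Delta>"
proof -
  \<comment> \<open>Selections are indexed by sets of pairs, so there are finitely many of them, as
    the theorem of alternatives requires.\<close>
  define ch where "ch S = filter_mset (\<lambda>x. x \<in> S) Xs" for S
  define L where "L S = \<Gamma> + image_mset snd (ch S)" for S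
  define R where "R S = \<Delta> + image_mset fst (ch S)" for S
  define f where "f x v = linear_val H v (snd x) - linear_val H v (fst x)" for x v
  define g where "g S v = total (linear_val H v) (R S) - total (linear_val H v) (L S)" for S v
  have dec_vars: "decided H A" if "A \<in># \<Gamma> + \<Delta>" for A
    using vars that by auto
  have dec_LR: "decided H A" if "A \<in># L S + R S" for A S
    using that dec_vars dec(1) by (auto simp: L_def R_def ch_def)
  have "\<exists>M K. M \<noteq> {#} \<and> set_mset M \<subseteq> Pow (set_mset Xs) \<and> set_mset K \<subseteq> H \<and>
      (\<forall>v. (\<Sum>S\<in>#M. g S v) = (\<Sum>x\<in>#K. f x v))"
  proof (rule farkas_alternative)
    show "linear_functional (f x)" for x
      unfolding f_def
      by (rule linear_functional_diff[OF linear_functional_linear_val linear_functional_linear_val])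
    show "linear_functional (g S)" for S
      unfolding g_def by (rule linear_functional_diff[OF linear_functional_total linear_functional_total])
  next
    fix v assume pos: "\<forall>x\<in>H. 0 \<le> f x v"
    have ev: "linear_val H v A = val v A" if "decided H A" for A
      using linear_val_eq_val[OF _ that] pos by (force simp: f_def)
    have tot: "total (linear_val H v) \<Theta> = total (val v) \<Theta>" if "\<forall>A\<in>#\<Theta>. decided H A" for \<Theta>
      using that by (induction \<Theta>) (simp_all add: ev)
    \<comment> \<open>Exactly the implications of negative value are kept: there the minimum is the
      difference, elsewhere it is 0.\<close>
    define S where "S = {x \<in> set_mset Xs. val v (snd x) - val v (fst x) < 0}"
    have "ch S = filter_mset (\<lambda>x. val v (snd x) - val v (fst x) < 0) Xs"
      unfolding ch_def S_def by (rule filter_mset_cong) auto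
    then have "total (val v) (image_mset bimp Xs)
        = total (val v) (image_mset snd (ch S)) - total (val v) (image_mset fst (ch S))"
      by (simp only: total_bimp sum_mset_min_0)
         (simp add: sum_mset_rat_diff multiset.map_comp comp_def)
    then have "total (val v) (L S) \<le> total (val v) (R S)"
      using valid[of v] by (simp add: L_def R_def)
    then have "0 \<le> g S v"
      using dec_LR[of _ S] by (simp add: g_def tot)
    then show "\<exists>S\<in>Pow (set_mset Xs). 0 \<le> g S v"
      by (intro bexI[of _ S]) (auto simp: S_def)
  qed (use \<open>finite H\<close> in simp_all)
  then obtain M K where MK: "M \<noteq> {#}" "set_mset K \<subseteq> H"
    "\<And>v. (\<Sum>S\<in>#M. g S v) = (\<Sum>x\<in>#K. f x v)" by blast
  \<comment> \<open>The Farkas identity says that the right sides exceed the left sides by the sum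
    of \<open>snd - fst\<close> over \<open>K\<close>; moving terms across gives an equality of
    linear forms.\<close>
  have "GAs_under H ((\<Sum>S\<in>#M. L S) + image_mset snd K) ((\<Sum>S\<in>#M. R S) + image_mset fst K)"
  proof (rule GAs_under_linear_equality)
    have "decided H A" if "A \<in># image_mset snd K + image_mset fst K" for A
      using that MK(2) dec(2) by force
    then show "\<forall>A\<in>#(\<Sum>S\<in>#M. L S) + image_mset snd K + ((\<Sum>S\<in>#M. R S) + image_mset fst K). decided H A"
      using dec_LR by (simp add: ball_Un) blast
    show "total (linear_val H v) ((\<Sum>S\<in>#M. L S) + image_mset snd K)
        = total (linear_val H v) ((\<Sum>S\<in>#M. R S) + image_mset fst K)" for v
      using MK(3)[of v]
      by (simp add: g_def f_def total_sum_mset sum_mset_rat_diff multiset.map_comp comp_def)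
  qed
  then have "GAs_under H (\<Sum>S\<in>#M. L S) (\<Sum>S\<in>#M. R S)"
    by (rule GAs_under_hypotheses[OF MK(2)])
  then have "GAs_under H (repeat_mset (size M) (\<Gamma> + image_mset bimp Xs)) (repeat_mset (size M) \<Delta>)"
  proof (rule GAs_under_map[rotated])
    show "GAs (repeat_mset (size M) (\<Gamma> + image_mset bimp Xs) + \<Theta> \<turnstile> repeat_mset (size M) \<Delta>)"
      if "GAs ((\<Sum>S\<in>#M. L S) + \<Theta> \<turnstile> (\<Sum>S\<in>#M. R S))" for \<Theta>
      using GAs_use_choices[of M ch Xs \<Gamma> \<Theta> \<Delta> "{#}"] that
      by (simp add: L_def R_def ch_def multiset_filter_subset)
  qed
  \<comment> \<open>\<open>M\<close> is nonempty, so the number of copies is positive, as (C)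
    demands.\<close>
  then show ?thesis by (rule GAs_under_C[rotated]) (use MK(1) in \<open>simp add: nonempty_has_size\<close>)
qed

lemma GAs_complete_atomic:
  assumes "\<forall>A\<in>#\<Gamma>. A \<in> range Var" "\<forall>A\<in>#\<Delta>. A \<in> range Var"
    and "\<And>v. total (val v) (\<Gamma> + image_mset bimp Xs) \<le> total (val v) \<Delta>"
  shows "GAs (\<Gamma> + image_mset bimp Xs \<turnstile> \<Delta>)"
proof -
  define Sub where "Sub = (\<Union>x\<in>set_mset Xs. subformulas (fst x) \<union> subformulas (snd x))"
  \<comment> \<open>Only implications nested inside arguments are collected, since these are the
    cancellable ones; the outermost ones are treated by selection.\<close>
  define Q where "Q = bimp -` Sub"
  have Sub_closed: "subformulas A \<subseteq> Sub" if "A \<in> Sub" for A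
  proof -
    obtain x where "x \<in># Xs" "A \<in> subformulas (fst x) \<union> subformulas (snd x)"
      using \<open>A \<in> Sub\<close> unfolding Sub_def by blast
    then have "subformulas A \<subseteq> subformulas (fst x) \<union> subformulas (snd x)"
      using subformulas_trans[of A "fst x"] subformulas_trans[of A "snd x"] by blast
    then show ?thesis using \<open>x \<in># Xs\<close> unfolding Sub_def by blast
  qed
  have "inj bimp" by (auto simp: inj_def)
  show ?thesis
  proof (rule GAs_under_split_all)
    show "finite Q"
      unfolding Q_def using \<open>inj bimp\<close>
      by (intro finite_vimageI) (auto simp: Sub_def finite_subformulas)
    show "cancellable (\<Gamma> + image_mset bimp Xs) (C \<^bold>\<Rightarrow> D)" if "(C, D) \<in> Q" for C D
    proof -
      have "C \<^bold>\<Rightarrow> D \<in> Sub" using that by (simp add: Q_def)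
      then obtain x where x: "x \<in># Xs" "C \<^bold>\<Rightarrow> D \<in> subformulas (fst x) \<union> subformulas (snd x)"
        unfolding Sub_def by blast
      have "bimp x \<in># \<Gamma> + image_mset bimp Xs" using x(1) by simp
      moreover have "bimp x = fst x \<^bold>\<Rightarrow> snd x" by (cases x) simp
      ultimately show ?thesis using x(2) unfolding cancellable_def by auto
    qed
  next
    fix H assume H: "finite H" "H \<subseteq> Q \<union> Q\<inverse>" "Q \<subseteq> H \<union> H\<inverse>"
    have dec: "decided H A" if "A \<in> Sub" for A
      unfolding decided_def
    proof (intro allI impI)
      fix E F assume "E \<^bold>\<Rightarrow> F \<in> subformulas A"
      then have "(E, F) \<in> Q" using Sub_closed[OF that] by (auto simp: Q_def)
      then show "(E, F) \<in> H \<or> (F, E) \<in> H" using H(3) by blast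
    qed
    show "GAs_under H (\<Gamma> + image_mset bimp Xs) \<Delta>"
    proof (rule GAs_under_complete_orders)
      show "decided H A \<and> decided H B" if "(A, B) \<in># Xs" for A B
      proof -
        have "A \<in> Sub" "B \<in> Sub"
          unfolding Sub_def using that subformulas_self[of A] subformulas_self[of B]
          by (auto intro!: bexI[of _ "(A, B)"])
        then show ?thesis by (simp add: dec)
      qed
      show "decided H C \<and> decided H D" if "(C, D) \<in> H" for C D
      proof -
        \<comment> \<open>\<open>H\<close> may hold a pair of \<open>Q\<close> reversed, but either
          implication, being decided, has both arguments decided.\<close>
        have "C \<^bold>\<Rightarrow> D \<in> Sub \<or> D \<^bold>\<Rightarrow> C \<in> Sub" using that H(2) by (auto simp: Q_def)
        then show ?thesis using dec[of "C \<^bold>\<Rightarrow> D"] dec[of "D \<^bold>\<Rightarrow> C"] by auto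
      qed
    qed (rule assms H(1))+
  qed
qed

lemma flat_mset_split:
  "\<forall>A\<in>#\<Gamma>. flat A \<Longrightarrow> \<exists>\<Gamma>' Xs. \<Gamma> = \<Gamma>' + image_mset bimp Xs \<and> (\<forall>A\<in>#\<Gamma>'. A \<in> range Var)"
proof (induction \<Gamma>)
  case (add A \<Gamma>)
  then obtain \<Gamma>' Xs where \<Gamma>: "\<Gamma> = \<Gamma>' + image_mset bimp Xs" "\<forall>A\<in>#\<Gamma>'. A \<in> range Var" by auto
  consider "A \<in> range Var" | x where "A = bimp x" using add.prems by (auto simp: flat_def)
  then show ?case
  proof cases
    case 1
    then show ?thesis using \<Gamma> by (intro exI[of _ "add_mset A \<Gamma>'"] exI[of _ Xs]) simp
  next
    case 2
    then show ?thesis using \<Gamma> by (intro exI[of _ \<Gamma>'] exI[of _ "add_mset x Xs"]) simp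
  qed
qed simp

text \<open>The right rule for \<open>\<Rightarrow>\<close> preserves validity upwards, because the
  minimum is at most 0 and at most the difference. Hence implications on the right can be removed
  until only variables stand there.\<close>

lemma GAs_complete:
  fixes \<Gamma> \<Delta> :: "'p form multiset"
  assumes "\<And>v. total (val v) \<Gamma> \<le> total (val v) \<Delta>"
  shows "GAs (\<Gamma> \<turnstile> \<Delta>)"
proof (rule decomposition_induct[where e = val and P = "\<lambda>d. \<forall>v. 0 \<le> d v"
      and D = "\<lambda>\<Gamma> \<Delta>. GAs (\<Gamma> \<turnstile> \<Delta>)"])
  fix \<Gamma> \<Delta> :: "'p form multiset"
  assume flat: "\<forall>A\<in>#\<Gamma> + \<Delta>. flat A"
    and IH: "\<And>\<Gamma>' \<Delta>' :: 'p form multiset. (\<Sum>A\<in>#\<Gamma>' + \<Delta>'. weight A) < (\<Sum>A\<in>#\<Gamma> + \<Delta>. weight A) \<Longrightarrow>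
      \<forall>v. 0 \<le> total (val v) \<Delta>' - total (val v) \<Gamma>' \<Longrightarrow> GAs (\<Gamma>' \<turnstile> \<Delta>')"
    and valid: "\<forall>v. 0 \<le> total (val v) \<Delta> - total (val v) \<Gamma>"
  have "\<forall>A\<in>#\<Delta>. flat A" using flat by simp
  then show "GAs (\<Gamma> \<turnstile> \<Delta>)"
  proof (cases rule: mem_flat_cases)
    case 1
    obtain \<Gamma>' Xs where "\<Gamma> = \<Gamma>' + image_mset bimp Xs" "\<forall>A\<in>#\<Gamma>'. A \<in> range Var"
      using flat_mset_split[of \<Gamma>] flat by auto
    then show ?thesis using GAs_complete_atomic[of \<Gamma>' \<Delta> Xs] 1 valid by simp
  next
    case (2 E F \<Delta>')
    have le: "total (val v) \<Gamma> \<le> min 0 (val v F - val v E) + total (val v) \<Delta>'" for v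
      using valid[rule_format, of v] by (simp add: 2)
    have "GAs (\<Gamma> \<turnstile> \<Delta>')"
    proof (rule IH)
      show "\<forall>v. 0 \<le> total (val v) \<Delta>' - total (val v) \<Gamma>"
      proof
        show "0 \<le> total (val v) \<Delta>' - total (val v) \<Gamma>" for v using le[of v] by linarith
      qed
    qed (simp add: 2)
    moreover have "GAs (add_mset E \<Gamma> \<turnstile> add_mset F \<Delta>')"
    proof (rule IH)
      show "\<forall>v. 0 \<le> total (val v) (add_mset F \<Delta>') - total (val v) (add_mset E \<Gamma>)"
      proof
        show "0 \<le> total (val v) (add_mset F \<Delta>') - total (val v) (add_mset E \<Gamma>)" for v
          using le[of v] by simp
      qed
    qed (simp add: 2)
    ultimately show ?thesis unfolding 2 by (rule GAs_BImpR)
  qed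
qed (simp_all add: assms group_value_val GAs_tL GAs_tR GAs_NegL GAs_NegR GAs_PlusL GAs_PlusR
    GAs_ImpL GAs_ImpR)

theorem mainTheorem19:
  fixes S :: "'p sequent"
  assumes "\<Turnstile>\<^sub>A S"
  shows "GAs S"
proof (cases S)
  case (Sequent \<Gamma> \<Delta>)
  then show ?thesis using assms by (auto intro!: GAs_complete simp: valuation_val)
qed

end
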